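(* Let $V$ be a valuation domain. Then: (1) For every nonzero ideal $I$ of $V$, $\tilde{\tilde{I}}=\tilde{I}$. (2) One has $\tilde{I}\subseteq\tilde{J}$ for all nonzero ideals $I\subseteq J$ of $V$ if and only if each nonzero nonmaximal prime ideal of $V$ is not idempotent.
   Context: For an integral domain $R$ and a nonzero (integral) ideal $I$ of $R$, the Ratliff-Rush closure of $I$ is the ideal $\tilde{I}=\bigcup_{n\ge 1}(I^{n+1}:_R I^n)$, where $(I^{n+1}:_R I^n)=\{x\in R : xI^n\subseteq I^{n+1}\}$. Here $R=V$. An ideal $P$ is idempotent if $P^2=P$. *)

theory Defs
  imports "HOL-Algebra.Ideal_Product" "HOL-Algebra.Divisibility"
begin

locale valuation_domain = "domain" R for R (structure) +
  assumes divides_total: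
    "\<lbrakk> a \<in> carrier R; b \<in> carrier R \<rbrakk> \<Longrightarrow> a divides b \<or> b divides a"

definition ideal_colon :: "('a, 'b) ring_scheme \<Rightarrow> 'a set \<Rightarrow> 'a set \<Rightarrow> 'a set"
  where "ideal_colon R I J = {x \<in> carrier R. \<forall>y\<in>J. x \<otimes>\<^bsub>R\<^esub> y \<in> I}"

(* Powers of ideals are powers in the monoid of ideals (ideals_set R), whose
   product is ideal_prod and whose unit is carrier R. *)
definition ratliff_rush :: "('a, 'b) ring_scheme \<Rightarrow> 'a set \<Rightarrow> 'a set"
  where "ratliff_rush R I =
    (\<Union>n\<in>{1::nat..}. ideal_colon R (I [^]\<^bsub>ideals_set R\<^esub> (n + 1)) (I [^]\<^bsub>ideals_set R\<^esub> n))"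

definition idempotent_ideal :: "('a, 'b) ring_scheme \<Rightarrow> 'a set \<Rightarrow> bool"
  where "idempotent_ideal R P \<longleftrightarrow> P [^]\<^bsub>ideals_set R\<^esub> (2::nat) = P"

end

theory Submission
  imports Defs
begin

text \<open>
  In a valuation domain the ideals form a chain, and the product of two ideals consists of the
  plain products of their elements. Everything rests on the following observation
  (\<open>ratliff_rush_diff_imp\<close>): if \<open>x\<close> lies in the Ratliff-Rush closure of \<open>I\<close> but not in \<open>I\<close>, then
  \<open>I = x A\<close> for an ideal \<open>A\<close>, and cancelling \<open>x\<^sup>n\<^sup>+\<^sup>1\<close> in \<open>x I\<^sup>n \<subseteq> I\<^sup>n\<^sup>+\<^sup>1\<close> gives \<open>A\<^sup>n \<subseteq> A\<^sup>n\<^sup>+\<^sup>1\<close>. This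
  forces \<open>A\<close> itself to be idempotent (\<open>idem_if_power_stable\<close>), because an idempotent ideal \<open>B\<close>
  satisfies the primality implication \<open>x y \<in> B \<Longrightarrow> x \<in> B \<or> y \<in> B\<close>. So the closure is
  nontrivial only for ideals \<open>x P\<close> with \<open>P\<close> an idempotent prime, and there it is the colon ideal
  \<open>(x P : P)\<close> (\<open>ratliff_rush_scaled_idem\<close>).

  Suppose now that \<open>J = (x P : P)\<close> is the closure of \<open>I = x P\<close>, with \<open>x \<in> J - I\<close>, and that
  \<open>z\<close> is in the closure of \<open>J\<close> but not in \<open>J\<close>. Then \<open>J = z Q\<close> with \<open>Q\<close> idempotent, and
  \<open>z Q P \<subseteq> x P\<close>. If \<open>Q \<subseteq> P\<close>, then
  \<open>x \<in> z Q = z Q Q \<subseteq> z Q P \<subseteq> x P = I\<close>; if \<open>P \<subseteq> Q\<close>, then \<open>z P = z P P \<subseteq> z Q P \<subseteq> x P\<close>,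
  that is, \<open>z \<in> J\<close>. Both are absurd, hence the closure operation is idempotent.

  If no nonzero nonmaximal prime is idempotent, an element \<open>x\<close> of the closure of \<open>I\<close> outside the
  closure of \<open>J \<supseteq> I\<close> gives \<open>I = x M\<close> with \<open>M\<close> maximal; as \<open>x \<notin> J\<close>, also \<open>J = x A\<close> with
  \<open>M \<subseteq> A \<noteq> V\<close>, so \<open>A = M\<close> and \<open>J = I\<close>, a contradiction. Conversely, if \<open>P\<close> is a nonzero nonmaximal idempotent prime and \<open>a \<notin> P\<close> is a
  nonunit, then \<open>P \<subseteq> a V\<close>, while the closure of \<open>P\<close> is \<open>V\<close> and that of \<open>a V\<close> is \<open>a V\<close>.
\<close>

section \<open>Ideals of a valuation domain\<close>

context valuation_domain
begin

lemma divisor_if_notin_ideal: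
  assumes "ideal I R" "x \<in> carrier R" "x \<notin> I" "i \<in> I"
  shows "\<exists>c\<in>carrier R. i = x \<otimes> c"
proof -
  have i: "i \<in> carrier R" using assms ideal.Icarr by metis
  have "\<not> i divides x" using assms ideal.I_r_closed unfolding factor_def by metis
  then show ?thesis using divides_total[OF i assms(2)] unfolding factor_def by blast
qed

lemma ideals_total:
  assumes "ideal I R" "ideal J R"
  shows "I \<subseteq> J \<or> J \<subseteq> I"
proof (rule disjCI)
  assume "\<not> J \<subseteq> I"
  then obtain x where x: "x \<in> J" "x \<notin> I" by blast
  then have "x \<in> carrier R" using assms(2) ideal.Icarr by metis
  then show "I \<subseteq> J"
    using divisor_if_notin_ideal[OF assms(1) _ x(2)] ideal.I_r_closed[OF assms(2) x(1)] by blast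
qed

lemma ideal_prod_eq_set_mult:
  assumes I: "ideal I R" and J: "ideal J R"
  shows "I \<cdot> J = I <#> J"
proof
  show "I <#> J \<subseteq> I \<cdot> J"
    unfolding set_mult_def using ideal_prod.prod by fast
next
  show "I \<cdot> J \<subseteq> I <#> J"
  proof
    fix s assume "s \<in> I \<cdot> J"
    then show "s \<in> I <#> J"
    proof (induct s rule: ideal_prod.induct)
      case (prod i j)
      then show ?case unfolding set_mult_def by blast
    next
      case (sum s t)
      \<comment> \<open>Of the two first factors one divides the other, so it is a common factor of both terms.\<close>
      have *: "i \<otimes> j \<oplus> i' \<otimes> j' \<in> I <#> J"
        if "i \<in> I" "j \<in> J" "i' \<in> I" "j' \<in> J" "i divides i'" for i j i' j'
      proof -
        obtain c where c: "c \<in> carrier R" "i' = i \<otimes> c" using \<open>i divides i'\<close> unfolding factor_def by blast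
        have carr: "i \<in> carrier R" "j \<in> carrier R" "j' \<in> carrier R"
          using that I J ideal.Icarr by metis+
        have "i \<otimes> j \<oplus> i' \<otimes> j' = i \<otimes> (j \<oplus> c \<otimes> j')"
          using carr c by (simp add: r_distr m_assoc)
        moreover have "j \<oplus> c \<otimes> j' \<in> J"
          using that c J
          by (simp add: additive_subgroup.a_closed ideal.axioms(1) ideal.I_l_closed)
        ultimately show ?thesis using \<open>i \<in> I\<close> unfolding set_mult_def by blast
      qed
      obtain i j i' j' where ij: "i \<in> I" "j \<in> J" "i' \<in> I" "j' \<in> J" "s = i \<otimes> j" "t = i' \<otimes> j'"
        using sum unfolding set_mult_def by blast
      have carr: "i \<in> carrier R" "j \<in> carrier R" "i' \<in> carrier R" "j' \<in> carrier R"
        using ij I J ideal.Icarr by metis+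
      then have comm: "i \<otimes> j \<oplus> i' \<otimes> j' = i' \<otimes> j' \<oplus> i \<otimes> j" by (simp add: a_comm)
      show ?case
        using divides_total[OF carr(1) carr(3)] *[of i j i' j'] *[of i' j' i j] ij comm by auto
    qed
  qed
qed

lemma mem_ideal_prod_iff:
  assumes "ideal I R" "ideal J R"
  shows "s \<in> I \<cdot> J \<longleftrightarrow> (\<exists>i\<in>I. \<exists>j\<in>J. s = i \<otimes> j)"
  unfolding ideal_prod_eq_set_mult[OF assms] set_mult_def by blast

lemma ideal_pow_0: "I [^]\<^bsub>ideals_set R\<^esub> (0::nat) = carrier R"
  by (simp add: ideals_set_def)

lemma ideal_pow_Suc: "I [^]\<^bsub>ideals_set R\<^esub> Suc n = (I [^]\<^bsub>ideals_set R\<^esub> n) \<cdot> I"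
  by (simp add: ideals_set_def)

lemma ideal_pow_ideal: "ideal I R \<Longrightarrow> ideal (I [^]\<^bsub>ideals_set R\<^esub> (n::nat)) R"
  by (induct n) (simp_all only: ideal_pow_0 ideal_pow_Suc oneideal ideal_prod_is_ideal)

lemma ideal_pow_add:
  assumes "ideal I R"
  shows "I [^]\<^bsub>ideals_set R\<^esub> (m + n) = (I [^]\<^bsub>ideals_set R\<^esub> m) \<cdot> (I [^]\<^bsub>ideals_set R\<^esub> (n::nat))"
proof -
  interpret M: comm_monoid "ideals_set R" by (rule ideals_set_is_comm_monoid)
  show ?thesis using M.nat_pow_mult[of I m n] assms by (simp add: ideals_set_def)
qed

lemma idempotent_ideal_iff:
  assumes "ideal I R"
  shows "idempotent_ideal R I \<longleftrightarrow> I \<cdot> I = I"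
proof -
  have "carrier R \<cdot> I = I"
    using ideal_prod_one ideal_prod_commute oneideal assms by metis
  then show ?thesis
    unfolding idempotent_ideal_def numeral_2_eq_2 by (simp only: ideal_pow_0 ideal_pow_Suc)
qed

lemma ideal_pow_idem:
  assumes "ideal A R" "A \<cdot> A = A"
  shows "A [^]\<^bsub>ideals_set R\<^esub> Suc n = A"
proof (induct n)
  case 0
  show ?case
    unfolding ideal_pow_Suc ideal_pow_0
    using ideal_prod_one ideal_prod_commute oneideal assms by metis
next
  case (Suc n)
  then show ?case unfolding ideal_pow_Suc[of A "Suc n"] using assms by simp
qed


section \<open>Scaled ideals\<close>

text \<open>The left coset \<open>x <# A\<close>, taken in the multiplicative monoid, is the ideal \<open>x A\<close>.\<close>

lemma mem_scaled_iff: "s \<in> x <# A \<longleftrightarrow> (\<exists>a\<in>A. s = x \<otimes> a)"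
  unfolding l_coset_def by blast

lemma nat_pow_nonzero:
  assumes "x \<in> carrier R" "x \<noteq> \<zero>"
  shows "x [^] (n::nat) \<noteq> \<zero>"
  using assms integral_iff by (induct n) auto

lemma scaled_cancel:
  assumes "ideal A R" "x \<in> carrier R" "x \<noteq> \<zero>" "a \<in> carrier R"
  shows "x \<otimes> a \<in> x <# A \<longleftrightarrow> a \<in> A"
  unfolding mem_scaled_iff using assms m_lcancel ideal.Icarr by metis

lemma ideal_prod_scaled:
  assumes A: "ideal A R" and B: "ideal B R" and sA: "ideal (x <# A) R" and sB: "ideal (y <# B) R"
    and x: "x \<in> carrier R" and y: "y \<in> carrier R"
  shows "(x <# A) \<cdot> (y <# B) = (x \<otimes> y) <# (A \<cdot> B)"
proof -
  have *: "(x \<otimes> a) \<otimes> (y \<otimes> b) = (x \<otimes> y) \<otimes> (a \<otimes> b)" if "a \<in> A" "b \<in> B" for a b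
    using that x y ideal.Icarr[OF A that(1)] ideal.Icarr[OF B that(2)] by (simp add: m_ac)
  show ?thesis
  proof (rule Set.set_eqI)
    fix s
    have "s \<in> (x <# A) \<cdot> (y <# B) \<longleftrightarrow> (\<exists>a\<in>A. \<exists>b\<in>B. s = (x \<otimes> a) \<otimes> (y \<otimes> b))"
      unfolding mem_ideal_prod_iff[OF sA sB] unfolding l_coset_def by auto
    also have "\<dots> \<longleftrightarrow> (\<exists>a\<in>A. \<exists>b\<in>B. s = (x \<otimes> y) \<otimes> (a \<otimes> b))"
      by (simp add: * cong: bex_cong)
    also have "\<dots> \<longleftrightarrow> s \<in> (x \<otimes> y) <# (A \<cdot> B)"
      unfolding mem_scaled_iff Bex_def mem_ideal_prod_iff[OF A B] by blast
    finally show "s \<in> (x <# A) \<cdot> (y <# B) \<longleftrightarrow> s \<in> (x \<otimes> y) <# (A \<cdot> B)" .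
  qed
qed

lemma ideal_pow_scaled:
  assumes A: "ideal A R" and sA: "ideal (x <# A) R" and x: "x \<in> carrier R"
  shows "(x <# A) [^]\<^bsub>ideals_set R\<^esub> n = (x [^] n) <# (A [^]\<^bsub>ideals_set R\<^esub> (n::nat))"
proof (induct n)
  case 0
  then show ?case unfolding ideal_pow_0 by (auto simp: mem_scaled_iff)
next
  case (Suc n)
  have "ideal ((x [^] n) <# (A [^]\<^bsub>ideals_set R\<^esub> n)) R"
    using ideal_pow_ideal[OF sA, of n] Suc by simp
  then show ?case
    unfolding ideal_pow_Suc Suc using ideal_prod_scaled[OF ideal_pow_ideal[OF A] A _ sA _ x] x by simp
qed

lemma ideal_colon_ideal:
  assumes I: "ideal I R" and J: "ideal J R"
  shows "ideal (ideal_colon R I J) R"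
proof (rule idealI[OF ring_axioms])
  have Jc: "\<And>y. y \<in> J \<Longrightarrow> y \<in> carrier R" using J ideal.Icarr by metis
  interpret I: ideal I R by (rule I)
  show "subgroup (ideal_colon R I J) (add_monoid R)"
  proof (rule add.subgroupI)
    show "ideal_colon R I J \<noteq> {}"
      using Jc I.zero_closed unfolding ideal_colon_def by force
  next
    fix a assume "a \<in> ideal_colon R I J"
    then show "\<ominus> a \<in> ideal_colon R I J"
      unfolding ideal_colon_def using Jc I.a_inv_closed by (auto simp: l_minus)
  qed (use Jc in \<open>auto simp: ideal_colon_def l_distr\<close>)
  fix a x assume a: "a \<in> ideal_colon R I J" and x: "x \<in> carrier R"
  show "x \<otimes> a \<in> ideal_colon R I J"
    using a x Jc I.I_l_closed unfolding ideal_colon_def by (auto simp: m_assoc)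
  then show "a \<otimes> x \<in> ideal_colon R I J"
    using a x unfolding ideal_colon_def by (auto simp: m_comm)
qed

text \<open>If \<open>x \<notin> I\<close>, then \<open>x\<close> divides all elements of \<open>I\<close>, and the quotients form the ideal \<open>(I : x)\<close>.\<close>

lemma eq_scaled_if_notin:
  assumes I: "ideal I R" and x: "x \<in> carrier R" "x \<notin> I"
  shows "I = x <# ideal_colon R I {x}"
proof
  show "I \<subseteq> x <# ideal_colon R I {x}"
  proof
    fix i assume i: "i \<in> I"
    then obtain c where "c \<in> carrier R" "i = x \<otimes> c" using divisor_if_notin_ideal[OF I x] by blast
    then show "i \<in> x <# ideal_colon R I {x}"
      using i x unfolding mem_scaled_iff ideal_colon_def by (auto simp: m_comm)
  qed
  show "x <# ideal_colon R I {x} \<subseteq> I"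
    using x unfolding mem_scaled_iff ideal_colon_def l_coset_def by (auto simp: m_comm)
qed

lemma ideal_colon_singleton_ideal:
  assumes I: "ideal I R" and x: "x \<in> carrier R"
  shows "ideal (ideal_colon R I {x}) R"
proof -
  have "ideal_colon R I {x} = ideal_colon R I (PIdl x)"
  proof -
    have "c \<otimes> (r \<otimes> x) \<in> I" if "c \<otimes> x \<in> I" "c \<in> carrier R" "r \<in> carrier R" for c r
      using ideal.I_l_closed[OF I that(1) that(3)] that x by (simp add: m_lcomm)
    then show ?thesis
      using cgenideal_self[OF x] unfolding ideal_colon_def cgenideal_def by blast
  qed
  then show ?thesis using ideal_colon_ideal[OF I cgenideal_ideal[OF x]] by simp
qed


section \<open>Idempotent ideals\<close>

text \<open>An idempotent ideal is prime or the whole ring: if \<open>y \<notin> B\<close>, then \<open>B \<subseteq> y V\<close> and therefore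
  \<open>B = B B \<subseteq> y B\<close>, so that \<open>x y \<in> B\<close> yields \<open>x \<in> B\<close>.\<close>

lemma idem_ideal_prime:
  assumes B: "ideal B R" "B \<subseteq> B \<cdot> B"
    and xy: "x \<in> carrier R" "y \<in> carrier R" "x \<otimes> y \<in> B"
  shows "x \<in> B \<or> y \<in> B"
proof (rule disjCI)
  assume y: "y \<notin> B"
  have y0: "y \<noteq> \<zero>" using y B(1) additive_subgroup.zero_closed ideal.axioms(1) by metis
  obtain b b' where b: "b \<in> B" "b' \<in> B" "x \<otimes> y = b \<otimes> b'"
    using xy(3) B mem_ideal_prod_iff by blast
  obtain c where c: "c \<in> carrier R" "b = y \<otimes> c"
    using divisor_if_notin_ideal[OF B(1) xy(2) y b(1)] by blast
  have b': "b' \<in> carrier R" using b(2) B(1) ideal.Icarr by metis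
  have "y \<otimes> x = y \<otimes> (c \<otimes> b')" using b(3) c b' xy by (simp add: m_ac)
  then have "x = c \<otimes> b'" using m_lcancel[OF y0] xy c b' by simp
  then show "x \<in> B" using ideal.I_l_closed[OF B(1) b(2) c(1)] by simp
qed

lemma idem_ideal_radical:
  assumes B: "ideal B R" "B \<subseteq> B \<cdot> B" and a: "a \<in> carrier R" "a [^] (n::nat) \<in> B"
  shows "a \<in> B"
  using a(2)
proof (induct n)
  case 0
  then show ?case using ideal.one_imp_carrier[OF B(1)] a(1) by simp
next
  case (Suc n)
  then show ?case using idem_ideal_prime[OF B, of "a [^] n" a] a(1) by auto
qed

lemma pow_mem_ideal_pow:
  assumes "ideal A R" "a \<in> A"
  shows "a [^] (n::nat) \<in> A [^]\<^bsub>ideals_set R\<^esub> n"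
proof (induct n)
  case 0
  then show ?case by (simp only: ideal_pow_0 nat_pow_0 one_closed)
next
  case (Suc n)
  then show ?case
    unfolding ideal_pow_Suc using assms(2) by (simp add: ideal_prod.prod)
qed

text \<open>If the powers of \<open>A\<close> become stationary at \<open>A\<^sup>n\<close>, that power is idempotent, hence contains
  \<open>A\<close> by primality.\<close>

lemma idem_if_power_stable:
  assumes A: "ideal A R" and n: "n \<ge> 1"
    and st: "A [^]\<^bsub>ideals_set R\<^esub> n \<subseteq> A [^]\<^bsub>ideals_set R\<^esub> Suc n"
  shows "A \<cdot> A = A"
proof -
  let ?P = "\<lambda>k::nat. A [^]\<^bsub>ideals_set R\<^esub> k"
  have mono: "I \<cdot> K \<subseteq> J \<cdot> K" if "ideal I R" "ideal J R" "ideal K R" "I \<subseteq> J" for I J K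
    using that mem_ideal_prod_iff by blast
  have step: "?P (n + k) \<subseteq> ?P (Suc n + k)" for k
    unfolding ideal_pow_add[OF A] by (rule mono[OF _ _ _ st]) (simp_all only: ideal_pow_ideal[OF A])
  have "?P n \<subseteq> ?P (n + k)" for k
  proof (induct k)
    case (Suc k)
    then show ?case using step[of k] by simp
  qed simp
  then have idem: "?P n \<subseteq> ?P n \<cdot> ?P n"
    using ideal_pow_add[OF A] by metis
  have A_le: "A \<subseteq> ?P n"
    using idem_ideal_radical[OF ideal_pow_ideal[OF A] idem] pow_mem_ideal_pow[OF A] ideal.Icarr[OF A]
    by blast
  obtain m where m: "n = Suc m" using n by (cases n) auto
  have "?P n \<subseteq> A"
    unfolding m ideal_pow_Suc using ideal_prod_inter[OF ideal_pow_ideal[OF A] A] by blast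
  then have "?P n \<cdot> A \<subseteq> A \<cdot> A" using mono ideal_pow_ideal A by blast
  then have "A \<subseteq> A \<cdot> A" using A_le st unfolding ideal_pow_Suc by blast
  moreover have "A \<cdot> A \<subseteq> A" using ideal_prod_inter[OF A A] by blast
  ultimately show ?thesis by blast
qed


section \<open>The Ratliff-Rush closure\<close>

lemma mem_ratliff_rush_iff:
  "x \<in> ratliff_rush R I \<longleftrightarrow> (\<exists>n\<ge>1. x \<in> carrier R \<and>
     (\<forall>y\<in>I [^]\<^bsub>ideals_set R\<^esub> n. x \<otimes> y \<in> I [^]\<^bsub>ideals_set R\<^esub> Suc n))"
  unfolding ratliff_rush_def ideal_colon_def by auto

lemma subset_ratliff_rush:
  assumes "ideal I R"
  shows "I \<subseteq> ratliff_rush R I"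
proof
  fix x assume x: "x \<in> I"
  have "\<forall>y\<in>I [^]\<^bsub>ideals_set R\<^esub> (1::nat). x \<otimes> y \<in> I [^]\<^bsub>ideals_set R\<^esub> Suc 1"
  proof
    fix y assume y: "y \<in> I [^]\<^bsub>ideals_set R\<^esub> (1::nat)"
    have "x \<in> carrier R" "y \<in> carrier R"
      using x y assms ideal_pow_ideal ideal.Icarr by metis+
    then have "x \<otimes> y = y \<otimes> x" by (rule m_comm)
    then show "x \<otimes> y \<in> I [^]\<^bsub>ideals_set R\<^esub> Suc 1"
      unfolding ideal_pow_Suc[of I 1] using ideal_prod.prod[OF y x, of R] by simp
  qed
  then show "x \<in> ratliff_rush R I"
    unfolding mem_ratliff_rush_iff using ideal.Icarr[OF assms x] order_refl by blast
qed

lemma ratliff_rush_diff_imp: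
  assumes I: "ideal I R" and x: "x \<in> ratliff_rush R I" "x \<notin> I"
  obtains P where "ideal P R" "P \<cdot> P = P" "I = x <# P" "x \<noteq> \<zero>" "x \<in> carrier R"
proof -
  obtain n where n: "n \<ge> 1" "x \<in> carrier R"
      "\<And>y. y \<in> I [^]\<^bsub>ideals_set R\<^esub> n \<Longrightarrow> x \<otimes> y \<in> I [^]\<^bsub>ideals_set R\<^esub> Suc n"
    using x(1) unfolding mem_ratliff_rush_iff by blast
  \<comment> \<open>Cancellation needs \<open>x \<noteq> \<zero>\<close>, which comes for free because \<open>\<zero> \<in> I\<close>.\<close>
  have x0: "x \<noteq> \<zero>" using x(2) I additive_subgroup.zero_closed ideal.axioms(1) by metis
  define A where "A = ideal_colon R I {x}"
  have A: "ideal A R" unfolding A_def using I n(2) by (rule ideal_colon_singleton_ideal)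
  have IA: "I = x <# A" unfolding A_def using I n(2) x(2) by (rule eq_scaled_if_notin)
  have pw: "I [^]\<^bsub>ideals_set R\<^esub> k = (x [^] k) <# (A [^]\<^bsub>ideals_set R\<^esub> k)" for k :: nat
    unfolding IA using A I[unfolded IA] n(2) by (rule ideal_pow_scaled)
  have xk0: "x [^] k \<noteq> \<zero>" for k :: nat using x0 n(2) nat_pow_nonzero by blast
  have "A [^]\<^bsub>ideals_set R\<^esub> n \<subseteq> A [^]\<^bsub>ideals_set R\<^esub> Suc n"
  proof
    fix a assume a: "a \<in> A [^]\<^bsub>ideals_set R\<^esub> n"
    have ac: "a \<in> carrier R" using a ideal.Icarr[OF ideal_pow_ideal[OF A]] by blast
    have "x \<otimes> (x [^] n \<otimes> a) \<in> (x [^] Suc n) <# (A [^]\<^bsub>ideals_set R\<^esub> Suc n)"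
      using n(3)[of "x [^] n \<otimes> a"] a unfolding pw mem_scaled_iff by blast
    moreover have "x \<otimes> (x [^] n \<otimes> a) = x [^] Suc n \<otimes> a"
      using n(2) ac by (simp add: m_ac)
    ultimately show "a \<in> A [^]\<^bsub>ideals_set R\<^esub> Suc n"
      using scaled_cancel[OF ideal_pow_ideal[OF A] _ xk0 ac] n(2) by (metis nat_pow_closed)
  qed
  then have "A \<cdot> A = A" by (rule idem_if_power_stable[OF A n(1)])
  then show thesis using that A IA x0 n(2) by blast
qed

lemma ratliff_rush_scaled_idem:
  assumes P: "ideal P R" "P \<cdot> P = P" and sP: "ideal (x <# P) R"
    and x: "x \<in> carrier R" "x \<noteq> \<zero>"
  shows "ratliff_rush R (x <# P) = ideal_colon R (x <# P) P"
proof -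
  \<comment> \<open>Only positive exponents: the zeroth power of every ideal is the whole ring.\<close>
  have pw: "(x <# P) [^]\<^bsub>ideals_set R\<^esub> Suc k = (x [^] Suc k) <# P" for k
    unfolding ideal_pow_scaled[OF P(1) sP x(1)] ideal_pow_idem[OF P] by simp
  have *: "(\<forall>y\<in>(x <# P) [^]\<^bsub>ideals_set R\<^esub> Suc k. z \<otimes> y \<in> (x <# P) [^]\<^bsub>ideals_set R\<^esub> Suc (Suc k))
        \<longleftrightarrow> (\<forall>p\<in>P. z \<otimes> p \<in> x <# P)" if z: "z \<in> carrier R" for z k
  proof -
    have "z \<otimes> (x [^] Suc k \<otimes> p) \<in> (x [^] Suc (Suc k)) <# P \<longleftrightarrow> z \<otimes> p \<in> x <# P"
      if p: "p \<in> P" for p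
    proof -
      have pc: "p \<in> carrier R" using p P(1) ideal.Icarr by metis
      let ?t = "x [^] Suc k"
      have t: "?t \<in> carrier R" "?t \<noteq> \<zero>" using x nat_pow_nonzero by blast+
      have e: "z \<otimes> (?t \<otimes> p) = ?t \<otimes> (z \<otimes> p)" using z t pc by (simp add: m_ac del: nat_pow_Suc)
      have "?t \<otimes> (z \<otimes> p) \<in> (x [^] Suc (Suc k)) <# P \<longleftrightarrow> (\<exists>q\<in>P. ?t \<otimes> (z \<otimes> p) = ?t \<otimes> (x \<otimes> q))"
        unfolding mem_scaled_iff nat_pow_Suc[of x "Suc k"]
        using t x ideal.Icarr[OF P(1)] m_assoc by metis
      also have "\<dots> \<longleftrightarrow> (\<exists>q\<in>P. z \<otimes> p = x \<otimes> q)"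
        using t x z pc ideal.Icarr[OF P(1)] m_lcancel m_closed by metis
      finally show ?thesis unfolding e mem_scaled_iff .
    qed
    then show ?thesis unfolding pw unfolding l_coset_def by auto
  qed
  have "z \<in> ratliff_rush R (x <# P) \<longleftrightarrow> z \<in> ideal_colon R (x <# P) P" for z
  proof
    assume "z \<in> ratliff_rush R (x <# P)"
    then obtain n where "n \<ge> 1" "z \<in> carrier R"
      "\<forall>y\<in>(x <# P) [^]\<^bsub>ideals_set R\<^esub> n. z \<otimes> y \<in> (x <# P) [^]\<^bsub>ideals_set R\<^esub> Suc n"
      unfolding mem_ratliff_rush_iff by blast
    then show "z \<in> ideal_colon R (x <# P) P"
      using *[of z "n - 1"] by (simp add: ideal_colon_def del: nat_pow_Suc)
  next
    assume "z \<in> ideal_colon R (x <# P) P"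
    then show "z \<in> ratliff_rush R (x <# P)"
      unfolding mem_ratliff_rush_iff ideal_colon_def using *[of z 0] by (auto intro!: exI[of _ "1::nat"] simp del: nat_pow_Suc)
  qed
  then show ?thesis by blast
qed

theorem ratliff_rush_idem:
  assumes I: "ideal I R"
  shows "ratliff_rush R (ratliff_rush R I) = ratliff_rush R I"
proof (cases "ratliff_rush R I \<subseteq> I")
  case True
  then have "ratliff_rush R I = I" using subset_ratliff_rush[OF I] by blast
  then show ?thesis by simp
next
  case False
  then obtain x where x: "x \<in> ratliff_rush R I" "x \<notin> I" by blast
  obtain P where P: "ideal P R" "P \<cdot> P = P" "I = x <# P" "x \<noteq> \<zero>" "x \<in> carrier R"
    using ratliff_rush_diff_imp[OF I x] by blast
  define J where "J = ratliff_rush R I"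
  have J_eq: "J = ideal_colon R (x <# P) P"
    unfolding J_def P(3) using P I by (intro ratliff_rush_scaled_idem) auto
  have J: "ideal J R" unfolding J_eq using I P by (intro ideal_colon_ideal) auto
  have "z \<in> J" if z: "z \<in> ratliff_rush R J" for z
  proof (rule ccontr)
    assume zJ: "z \<notin> J"
    obtain Q where Q: "ideal Q R" "Q \<cdot> Q = Q" "J = z <# Q" "z \<in> carrier R"
      using ratliff_rush_diff_imp[OF J z zJ] by blast
    have zqp: "z \<otimes> (q \<otimes> p) \<in> x <# P" if "q \<in> Q" "p \<in> P" for q p
    proof -
      have "z \<otimes> q \<in> J" unfolding Q(3) mem_scaled_iff using that by blast
      then have "(z \<otimes> q) \<otimes> p \<in> x <# P" unfolding J_eq ideal_colon_def using that by blast
      then show ?thesis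
        using that Q(4) ideal.Icarr[OF Q(1)] ideal.Icarr[OF P(1)] by (simp add: m_assoc)
    qed
    show False
    proof (cases "Q \<subseteq> P")
      case True
      obtain q where q: "q \<in> Q" "x = z \<otimes> q"
        using x(1) unfolding J_def[symmetric] Q(3) mem_scaled_iff by blast
      obtain q1 q2 where "q1 \<in> Q" "q2 \<in> Q" "q = q1 \<otimes> q2"
        using q(1) mem_ideal_prod_iff[OF Q(1) Q(1), of q, unfolded Q(2)] by blast
      then have "x \<in> x <# P" using zqp[of q1 q2] q(2) True by auto
      then show False using x(2) P(3) by blast
    next
      case False
      then have PQ: "P \<subseteq> Q" using ideals_total[OF P(1) Q(1)] by blast
      have "z \<otimes> p \<in> x <# P" if pP: "p \<in> P" for p
      proof -
        obtain p1 p2 where p: "p1 \<in> P" "p2 \<in> P" "p = p1 \<otimes> p2"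
          using pP mem_ideal_prod_iff[OF P(1) P(1), of p, unfolded P(2)] by blast
        then show ?thesis using zqp[OF subsetD[OF PQ p(1)] p(2)] by (simp only:)
      qed
      then show False using zJ Q(4) unfolding J_eq ideal_colon_def by blast
    qed
  qed
  then show ?thesis using subset_ratliff_rush[OF J] unfolding J_def by blast
qed

lemma ratliff_rush_idem_ideal:
  assumes P: "ideal P R" "P \<cdot> P = P"
  shows "ratliff_rush R P = carrier R"
proof
  show "carrier R \<subseteq> ratliff_rush R P"
  proof
    fix z assume z: "z \<in> carrier R"
    then have "\<forall>y\<in>P [^]\<^bsub>ideals_set R\<^esub> Suc 0. z \<otimes> y \<in> P [^]\<^bsub>ideals_set R\<^esub> Suc (Suc 0)"
      unfolding ideal_pow_idem[OF P] using ideal.I_l_closed[OF P(1)] by blast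
    then show "z \<in> ratliff_rush R P"
      unfolding mem_ratliff_rush_iff using z by (intro exI[of _ "Suc 0"]) simp
  qed
qed (auto simp: mem_ratliff_rush_iff)

lemma ratliff_rush_cgenideal:
  assumes a: "a \<in> carrier R" "a \<noteq> \<zero>"
  shows "ratliff_rush R (PIdl a) = PIdl a"
proof -
  have eq: "PIdl a = a <# carrier R"
    using a unfolding cgenideal_def l_coset_def by (auto simp: m_comm)
  have "ratliff_rush R (a <# carrier R) = ideal_colon R (a <# carrier R) (carrier R)"
    using a cgenideal_ideal[OF a(1)] unfolding eq
    by (intro ratliff_rush_scaled_idem oneideal ideal_prod_one) auto
  moreover have "ideal_colon R (a <# carrier R) (carrier R) \<subseteq> a <# carrier R"
    unfolding ideal_colon_def using r_one one_closed by fastforce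
  ultimately show ?thesis
    using subset_ratliff_rush[OF cgenideal_ideal[OF a(1)]] unfolding eq by blast
qed


section \<open>Monotonicity of the closure\<close>

lemma ratliff_rush_mono:
  assumes no_idem: "\<And>P. \<lbrakk>primeideal P R; P \<noteq> {\<zero>}; \<not> maximalideal P R\<rbrakk> \<Longrightarrow> P \<cdot> P \<noteq> P"
    and I: "ideal I R" "I \<noteq> {\<zero>}" and J: "ideal J R" and IJ: "I \<subseteq> J"
  shows "ratliff_rush R I \<subseteq> ratliff_rush R J"
proof
  fix x assume x: "x \<in> ratliff_rush R I"
  show "x \<in> ratliff_rush R J"
  proof (rule ccontr)
    assume xn: "x \<notin> ratliff_rush R J"
    then have xJ: "x \<notin> J" using subset_ratliff_rush[OF J] by blast
    then have xI: "x \<notin> I" using IJ by blast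
    obtain P where P: "ideal P R" "P \<cdot> P = P" "I = x <# P" "x \<noteq> \<zero>" "x \<in> carrier R"
      using ratliff_rush_diff_imp[OF I(1) x xI] by blast
    have proper: "P \<noteq> carrier R"
    proof
      assume "P = carrier R"
      then have "x \<otimes> \<one> \<in> I" unfolding P(3) mem_scaled_iff by blast
      then show False using xI P(5) by simp
    qed
    have "primeideal P R"
      using primeidealI[OF P(1) is_cring proper[symmetric]] idem_ideal_prime[OF P(1)] P(2) by simp
    moreover have "P \<noteq> {\<zero>}"
      using I(2) P(3,5) unfolding l_coset_def by auto
    ultimately have max: "maximalideal P R" using no_idem P(2) by blast
    define A where "A = ideal_colon R J {x}"
    have A: "ideal A R" unfolding A_def using J P(5) by (rule ideal_colon_singleton_ideal)
    have JA: "J = x <# A" unfolding A_def using J P(5) xJ by (rule eq_scaled_if_notin)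
    have "P \<subseteq> A"
    proof
      fix p assume p: "p \<in> P"
      then have "x \<otimes> p \<in> J" using IJ P(3) mem_scaled_iff by blast
      then show "p \<in> A"
        using scaled_cancel[OF A P(5,4)] ideal.Icarr[OF P(1) p] JA by simp
    qed
    moreover have "A \<noteq> carrier R"
      using xJ P(5) r_one one_closed unfolding JA mem_scaled_iff by metis
    ultimately have "A = P"
      using maximalideal.I_maximal[OF max A] ideal.Icarr[OF A] by blast
    then have "I = J" using P(3) JA by simp
    then show False using x xn by simp
  qed
qed

lemma not_ratliff_rush_mono:
  assumes P: "primeideal P R" "P \<noteq> {\<zero>}" "\<not> maximalideal P R" "P \<cdot> P = P"
  shows "\<exists>J. ideal J R \<and> J \<noteq> {\<zero>} \<and> P \<subseteq> J \<and> \<not> ratliff_rush R P \<subseteq> ratliff_rush R J"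
proof -
  have PI: "ideal P R" and proper: "carrier R \<noteq> P"
    using P(1) primeideal.axioms(1) primeideal.I_notcarr by blast+
  obtain K where K: "ideal K R" "P \<subseteq> K" "K \<noteq> P" "K \<noteq> carrier R"
    using maximalidealI[OF PI proper] P(3) by blast
  \<comment> \<open>Any element of \<open>K - P\<close> is a nonunit outside \<open>P\<close>.\<close>
  obtain a where a: "a \<in> K" "a \<notin> P" using K by blast
  have ac: "a \<in> carrier R" using a(1) K(1) ideal.Icarr by metis
  have a0: "a \<noteq> \<zero>" using a(2) PI additive_subgroup.zero_closed ideal.axioms(1) by metis
  have "P \<subseteq> PIdl a"
    using divisor_if_notin_ideal[OF PI ac a(2)] m_comm[OF ac] unfolding cgenideal_def by blast
  moreover have "PIdl a \<noteq> {\<zero>}" using cgenideal_self[OF ac] a0 by blast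
  moreover have "\<not> carrier R \<subseteq> PIdl a"
    using cgenideal_minimal[OF K(1) a(1)] K(4) ideal.Icarr[OF K(1)] by blast
  ultimately show ?thesis
    using cgenideal_ideal[OF ac] ratliff_rush_idem_ideal[OF PI P(4)] ratliff_rush_cgenideal[OF ac a0]
    by metis
qed

end

theorem proposition3p3:
  fixes V :: "('a, 'b) ring_scheme" (structure)
  assumes "valuation_domain V"
  shows "(\<forall>I. ideal I V \<and> I \<noteq> {\<zero>} \<longrightarrow>
            ratliff_rush V (ratliff_rush V I) = ratliff_rush V I) \<and>
         ((\<forall>I J. ideal I V \<and> I \<noteq> {\<zero>} \<and> ideal J V \<and> J \<noteq> {\<zero>} \<and> I \<subseteq> J \<longrightarrow>
              ratliff_rush V I \<subseteq> ratliff_rush V J) \<longleftrightarrow>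
          (\<forall>P. primeideal P V \<and> P \<noteq> {\<zero>} \<and> \<not> maximalideal P V \<longrightarrow>
              \<not> idempotent_ideal V P))"
proof -
  interpret valuation_domain V by (rule assms)
  have idem: "idempotent_ideal V P \<longleftrightarrow> P \<cdot> P = P" if "primeideal P V" for P
    using that idempotent_ideal_iff primeideal.axioms(1) by blast
  have "\<not> idempotent_ideal V P"
    if mono: "\<forall>I J. ideal I V \<and> I \<noteq> {\<zero>} \<and> ideal J V \<and> J \<noteq> {\<zero>} \<and> I \<subseteq> J \<longrightarrow>
        ratliff_rush V I \<subseteq> ratliff_rush V J"
      and P: "primeideal P V" "P \<noteq> {\<zero>}" "\<not> maximalideal P V" for P
    using not_ratliff_rush_mono[OF P] idem[OF P(1)] mono P(2) primeideal.axioms(1)[OF P(1)] by blast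
  moreover have "ratliff_rush V I \<subseteq> ratliff_rush V J"
    if "\<forall>P. primeideal P V \<and> P \<noteq> {\<zero>} \<and> \<not> maximalideal P V \<longrightarrow> \<not> idempotent_ideal V P"
      and "ideal I V" "I \<noteq> {\<zero>}" "ideal J V" "I \<subseteq> J" for I J
    using that idem by (intro ratliff_rush_mono) auto
  ultimately show ?thesis using ratliff_rush_idem by blast
qed

end
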